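(* Let a sequence of transactions be given, let $G^*$ be an optimal network for maximum profit (defined in the context), assumed connected, with node set $V$, and let $T$ be the set of transactions it executes, with $C_{opt}$ the total capital locked on its channels. Then for any star graph $S(V)$ on the node set $V$ (with any node of $V$ as center), the transactions of $T$ can be executed in order on $S(V)$ with total locked capital $C_S\le 2C_{opt}$. Hence any star graph yields a $2$-approximate solution for the Channel Design for All Transactions problem.
   Context: A transaction is a triple $(s_i,r_i,v_i)$ (sender, receiver, value $v_i>0$); the input is a sequence $t_1,\dots,t_n$. A network is an undirected graph of channels; each channel has nonnegative initial capital on each of its two sides; transactions are processed in order, each routed along a path from sender to receiver, moving its value from the traversing side to the other side of each edge on the path, with all sides nonnegative at all times. The total (locked) capital of a network is the sum of the initial capitals on all sides of all channels. Each executed transaction earns fee $1-\epsilon$ and each channel costs $1$; profit is (fees) minus (number of channels). Channel Design for All Transactions problem: given the sequence, return a graph that achieves maximum profit with minimum capital; such a graph (with its executed transactions and minimum capital assignment) is an optimal network for maximum profit. The paper assumes throughout this part that the optimal graph is connected. *)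

theory Defs
  imports Complex_Main "Graph_Theory.Digraph_Component" "Graph_Theory.Pair_Digraph"
begin

text \<open>
  An undirected simple graph is a finite loop-free symmetric digraph (locale pair_graph): the
  channel between u and v is the pair of opposite arcs (u,v) and (v,u).  The arc (u,v) also serves
  as the side of u on that channel, so a capital assignment is a real function on arcs.
  Its values outside the arcs of the graph are never looked at.
\<close>

type_synonym 'a transaction = "'a \<times> 'a \<times> real"

type_synonym 'a capital = "'a \<times> 'a \<Rightarrow> real"

definition channels :: "'a pair_pre_digraph \<Rightarrow> 'a set set" where
  "channels G = {{u, v} |u v. (u, v) \<in> parcs G}"

definition total_capital :: "'a pair_pre_digraph \<Rightarrow> 'a capital \<Rightarrow> real" where
  "total_capital G c = (\<Sum>e\<in>parcs G. c e)"

definition nonneg_capital :: "'a pair_pre_digraph \<Rightarrow> 'a capital \<Rightarrow> bool" where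
  "nonneg_capital G c \<longleftrightarrow> (\<forall>e\<in>parcs G. 0 \<le> c e)"

definition transfer :: "real \<Rightarrow> ('a \<times> 'a) list \<Rightarrow> 'a capital \<Rightarrow> 'a capital" where
  "transfer x p c = (\<lambda>(u, v).
     c (u, v) - (if (u, v) \<in> set p then x else 0) + (if (v, u) \<in> set p then x else 0))"

fun executes :: "'a pair_pre_digraph \<Rightarrow> 'a capital \<Rightarrow> 'a transaction list \<Rightarrow> bool" where
  "executes G c [] \<longleftrightarrow> nonneg_capital G c"
| "executes G c ((s, r, x) # ts) \<longleftrightarrow> nonneg_capital G c \<and>
     (\<exists>p. pre_digraph.apath (with_proj G) s p r \<and> executes G (transfer x p c) ts)"

text \<open>
  A network for the sequence ts consists of a graph G, the set I of positions of the executed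
  transactions (so that equal transactions at different positions are kept apart), and the initial
  capital c.
\<close>

definition network ::
  "'a transaction list \<Rightarrow> 'a pair_pre_digraph \<Rightarrow> nat set \<Rightarrow> 'a capital \<Rightarrow> bool" where
  "network ts G I c \<longleftrightarrow> pair_graph G \<and> I \<subseteq> {..<length ts} \<and> executes G c (nths ts I)"

definition profit :: "real \<Rightarrow> 'a pair_pre_digraph \<Rightarrow> nat set \<Rightarrow> real" where
  "profit eps G I = (1 - eps) * real (card I) - real (card (channels G))"

definition max_profit_network ::
  "real \<Rightarrow> 'a transaction list \<Rightarrow> 'a pair_pre_digraph \<Rightarrow> nat set \<Rightarrow> 'a capital \<Rightarrow> bool" where
  "max_profit_network eps ts G I c \<longleftrightarrow> network ts G I c \<and>
     (\<forall>G' I' c'. network ts G' I' c' \<longrightarrow> profit eps G' I' \<le> profit eps G I)"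

definition optimal_network ::
  "real \<Rightarrow> 'a transaction list \<Rightarrow> 'a pair_pre_digraph \<Rightarrow> nat set \<Rightarrow> 'a capital \<Rightarrow> bool" where
  "optimal_network eps ts G I c \<longleftrightarrow> max_profit_network eps ts G I c \<and>
     (\<forall>G' I' c'. max_profit_network eps ts G' I' c' \<longrightarrow> total_capital G c \<le> total_capital G' c')"

text \<open>The approximation factor concerns the capital; the maximum profit has to be attained.\<close>

definition approx_network ::
  "real \<Rightarrow> real \<Rightarrow> 'a transaction list \<Rightarrow> 'a pair_pre_digraph \<Rightarrow> nat set \<Rightarrow> 'a capital \<Rightarrow> bool" where
  "approx_network \<alpha> eps ts G I c \<longleftrightarrow> max_profit_network eps ts G I c \<and>
     (\<forall>G' I' c'. optimal_network eps ts G' I' c' \<longrightarrow>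
        total_capital G c \<le> \<alpha> * total_capital G' c')"

definition star :: "'a \<Rightarrow> 'a set \<Rightarrow> 'a pair_pre_digraph" where
  "star z V = \<lparr>pverts = V, parcs = {z} \<times> (V - {z}) \<union> (V - {z}) \<times> {z}\<rparr>"

end

theory Submission
  imports Defs
begin

text \<open>
  Give the side of v on the star channel between v and z the capital that v controls in G (the sum
  of its sides), and give the opposite side the capital facing v.  Routing a value along a path
  leaves both sums unchanged at inner vertices of the path, and at the two ends of the path it
  changes them exactly as the route through z changes the star; so the correspondence is preserved
  and all sides of the star stay nonnegative.  Every side of G is counted at most twice, once at
  each of its endpoints.  A connected graph has at least |V| - 1 channels, so the star earns at
  least the profit of G.
\<close>

definition out_capital :: "'a pair_pre_digraph \<Rightarrow> 'a capital \<Rightarrow> 'a \<Rightarrow> real" where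
  "out_capital G c w = (\<Sum>e | e \<in> parcs G \<and> fst e = w. c e)"

definition in_capital :: "'a pair_pre_digraph \<Rightarrow> 'a capital \<Rightarrow> 'a \<Rightarrow> real" where
  "in_capital G c w = (\<Sum>e | e \<in> parcs G \<and> snd e = w. c e)"

definition star_capital :: "'a \<Rightarrow> 'a pair_pre_digraph \<Rightarrow> 'a capital \<Rightarrow> 'a capital" where
  "star_capital z G c = (\<lambda>(u, v). if v = z then out_capital G c u else in_capital G c v)"

lemma star_simps [simp]:
  "pverts (star z V) = V"
  "parcs (star z V) = {z} \<times> (V - {z}) \<union> (V - {z}) \<times> {z}"
  by (simp_all add: star_def)

lemma transfer_altdef:
  "transfer x p c e =
     c e - (if e \<in> set p then x else 0) + (if prod.swap e \<in> set p then x else 0)"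
  by (cases e) (simp add: transfer_def)

text \<open>A walk enters each inner vertex as often as it leaves it, so the difference telescopes
  to the two ends.\<close>

lemma sum_list_fst_minus_snd:
  fixes w :: 'a
  assumes "pcas u p v"
  shows "(\<Sum>e\<leftarrow>p. of_bool (fst e = w)) - (\<Sum>e\<leftarrow>p. of_bool (snd e = w))
           = (of_bool (w = u) - of_bool (w = v) :: real)"
  using assms
proof (induction p arbitrary: u)
  case (Cons e p)
  then have "fst e = u" "pcas (snd e) p v" by auto
  with Cons.IH[of "snd e"] show ?case by (simp add: eq_commute[of w])
qed simp

text \<open>A repeated arc would repeat its tail. Distinctness matters because
  \<open>transfer\<close> tests membership in \<open>set p\<close>, whereas flow conservation counts
  list entries.\<close>

lemma distinct_if_distinct_pawalk_verts: "distinct (pawalk_verts u p) \<Longrightarrow> distinct p"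
proof (induction p arbitrary: u)
  case (Cons e p)
  have "fst ` set p \<subseteq> set (pawalk_verts (snd e) p)" for e :: "'a \<times> 'a"
    by (induction p arbitrary: e) (simp, fastforce)
  from this[of e] Cons show ?case by auto
qed simp

lemma (in pair_fin_digraph) sum_path_indicator:
  fixes x :: real
  assumes "set p \<subseteq> parcs G" "distinct p"
  shows "(\<Sum>e | e \<in> parcs G \<and> P e. if e \<in> set p then x else 0)
           = x * (\<Sum>e\<leftarrow>p. of_bool (P e))"
proof -
  have "(\<Sum>e | e \<in> parcs G \<and> P e. if e \<in> set p then x else 0) = (\<Sum>e\<in>set p. x * of_bool (P e))"
    using assms pair_finite_arcs by (intro sum.mono_neutral_cong) auto
  then show ?thesis
    using assms by (simp add: sum_distrib_left sum_list_distinct_conv_sum_set)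
qed

context pair_graph
begin

text \<open>By symmetry, \<open>prod.swap\<close> permutes the arcs. This turns the credit on
  reversed path arcs into a count of path arcs by their other end.\<close>

lemma sum_swap_arcs:
  "(\<Sum>e | e \<in> parcs G \<and> P e. f (prod.swap e)) = (\<Sum>e | e \<in> parcs G \<and> P (prod.swap e). f e)"
  by (rule sum.reindex_bij_witness[where i = prod.swap and j = prod.swap])
     (auto simp: arcs_symmetric)

text \<open>The first sum loses \<open>x\<close> for each path arc leaving \<open>w\<close> and
  gains \<open>x\<close> for each one entering it; in the second the signs are reversed. Flow
  conservation leaves only the terms at \<open>s\<close> and \<open>r\<close>.\<close>

lemma
  assumes "apath s p r"
  shows out_capital_transfer: "out_capital G (transfer x p c) w
          = out_capital G c w - x * of_bool (w = s) + x * of_bool (w = r)"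
    and in_capital_transfer: "in_capital G (transfer x p c) w
          = in_capital G c w + x * of_bool (w = s) - x * of_bool (w = r)"
proof -
  have p: "set p \<subseteq> parcs G" "distinct p" "pcas s p r"
    using assms distinct_if_distinct_pawalk_verts by (auto simp: apath_def awalk_def)
  note ind = sum_path_indicator[OF p(1,2)]
  have flow: "(\<Sum>e\<leftarrow>p. of_bool (fst e = w))
      = (\<Sum>e\<leftarrow>p. of_bool (snd e = w)) + (of_bool (w = s) - of_bool (w = r) :: real)"
    using sum_list_fst_minus_snd[OF p(3), of w] by simp
  show "out_capital G (transfer x p c) w
          = out_capital G c w - x * of_bool (w = s) + x * of_bool (w = r)"
    unfolding out_capital_def transfer_altdef sum.distrib sum_subtractf
      sum_swap_arcs[where f = "\<lambda>e. if e \<in> set p then x else 0"] ind fst_swap flow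
    by (simp add: algebra_simps)
  show "in_capital G (transfer x p c) w
          = in_capital G c w + x * of_bool (w = s) - x * of_bool (w = r)"
    unfolding in_capital_def transfer_altdef sum.distrib sum_subtractf
      sum_swap_arcs[where f = "\<lambda>e. if e \<in> set p then x else 0"] ind snd_swap flow
    by (simp add: algebra_simps)
qed

lemma pair_graph_star: "z \<in> pverts G \<Longrightarrow> pair_graph (star z (pverts G))"
  using pair_finite_verts
  by unfold_locales (auto simp: symmetric_def intro!: symI)

lemma nonneg_star_capital:
  assumes "nonneg_capital G c"
    and "\<And>e. e \<in> parcs (star z (pverts G)) \<Longrightarrow> d e = star_capital z G c e"
  shows "nonneg_capital (star z (pverts G)) d"
proof -
  have "0 \<le> star_capital z G c e" for e
    using assms(1)
    by (auto simp: star_capital_def out_capital_def in_capital_def nonneg_capital_def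
        split: prod.split intro!: sum_nonneg)
  with assms(2) show ?thesis by (simp add: nonneg_capital_def)
qed

text \<open>The case distinction keeps vertices from repeating: the detour through \<open>z\<close>
  is taken only between two distinct leaves.\<close>

lemma star_apath:
  assumes "z \<in> pverts G" "s \<in> pverts G" "r \<in> pverts G"
  defines "q \<equiv> if s = r then [] else if s = z \<or> r = z then [(s, r)] else [(s, z), (z, r)]"
  shows "pre_digraph.apath (with_proj (star z (pverts G))) s q r"
proof -
  interpret S: pair_graph "star z (pverts G)" using pair_graph_star[OF assms(1)] .
  show ?thesis using assms
    by (auto simp: S.apath_def S.awalk_def q_def)
qed

text \<open>
  The star capital is fixed only on the arcs of the star, since the transfer does not preserve its
  defining equation elsewhere.
\<close>
lemma executes_star:
  assumes "executes G c ts" "z \<in> pverts G"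
    and "\<And>e. e \<in> parcs (star z (pverts G)) \<Longrightarrow> d e = star_capital z G c e"
  shows "executes (star z (pverts G)) d ts"
  using assms
proof (induction ts arbitrary: c d)
  case Nil
  then show ?case using nonneg_star_capital by auto
next
  case (Cons t ts)
  obtain s r x where t: "t = (s, r, x)" by (cases t)
  from Cons.prems(1) obtain p where
    p: "nonneg_capital G c" "apath s p r" "executes G (transfer x p c) ts"
    by (auto simp: t)
  have sr: "s \<in> pverts G" "r \<in> pverts G"
    using awalkI_apath[OF p(2)] awalk_hd_in_verts awalk_last_in_verts by auto
  define q where
    "q = (if s = r then [] else if s = z \<or> r = z then [(s, r)] else [(s, z), (z, r)])"
  have "transfer x q d e = star_capital z G (transfer x p c) e"
    if e: "e \<in> parcs (star z (pverts G))" for e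
  proof -
    \<comment> \<open>As \<open>v\<close> is a leaf, \<open>q\<close> uses \<open>(v, z)\<close>
      exactly when \<open>v = s \<noteq> r\<close>, and \<open>(z, v)\<close> exactly when
      \<open>v = r \<noteq> s\<close>. If \<open>s = r\<close>, the two changes of each capital sum
      cancel.\<close>
    from e consider v where "e = (v, z)" "v \<noteq> z" | v where "e = (z, v)" "v \<noteq> z"
      by auto
    then show ?thesis
      using Cons.prems(3)[OF e]
      by cases (auto simp: transfer_altdef q_def star_capital_def out_capital_transfer[OF p(2)]
          in_capital_transfer[OF p(2)])
  qed
  with Cons.IH[OF p(3) \<open>z \<in> pverts G\<close>] have "executes (star z (pverts G)) (transfer x q d) ts"
    by blast
  moreover have "pre_digraph.apath (with_proj (star z (pverts G))) s q r"
    using star_apath[OF \<open>z \<in> pverts G\<close> sr] by (simp add: q_def)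
  moreover have "nonneg_capital (star z (pverts G)) d"
    using nonneg_star_capital p(1) Cons.prems(3) by blast
  ultimately show ?case by (auto simp: t)
qed

lemma sum_out_capital: "(\<Sum>v\<in>pverts G. out_capital G c v) = total_capital G c"
  and sum_in_capital: "(\<Sum>v\<in>pverts G. in_capital G c v) = total_capital G c"
  unfolding out_capital_def in_capital_def total_capital_def
  using pair_finite_verts pair_finite_arcs
  by (intro sum.group; force dest: arc_fst_in_verts arc_snd_in_verts)+

lemma total_star_capital_le:
  assumes "nonneg_capital G c"
  shows "total_capital (star z (pverts G)) (star_capital z G c) \<le> 2 * total_capital G c"
proof -
  let ?W = "pverts G - {z}"
  have nn: "0 \<le> out_capital G c v" "0 \<le> in_capital G c v" for v
    using assms by (auto simp: out_capital_def in_capital_def nonneg_capital_def intro!: sum_nonneg)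
  have "total_capital (star z (pverts G)) (star_capital z G c)
      = (\<Sum>e\<in>{z} \<times> ?W. star_capital z G c e) + (\<Sum>e\<in>?W \<times> {z}. star_capital z G c e)"
    unfolding total_capital_def star_simps using pair_finite_verts
    by (intro sum.union_disjoint) auto
  also have "(\<Sum>e\<in>{z} \<times> ?W. star_capital z G c e) = (\<Sum>v\<in>?W. in_capital G c v)"
    by (rule sum.reindex_bij_witness[where i = "Pair z" and j = snd])
       (auto simp: star_capital_def split: if_splits)
  also have "(\<Sum>e\<in>?W \<times> {z}. star_capital z G c e) = (\<Sum>v\<in>?W. out_capital G c v)"
    by (rule sum.reindex_bij_witness[where i = "\<lambda>v. (v, z)" and j = fst])
       (auto simp: star_capital_def split: if_splits)
  \<comment> \<open>Both estimates only add the nonnegative term at the center; over all vertices,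
    each sum counts every side of \<open>G\<close> once.\<close>
  also have "(\<Sum>v\<in>?W. in_capital G c v) \<le> (\<Sum>v\<in>pverts G. in_capital G c v)"
    using pair_finite_verts nn by (intro sum_mono2) auto
  also have "(\<Sum>v\<in>?W. out_capital G c v) \<le> (\<Sum>v\<in>pverts G. out_capital G c v)"
    using pair_finite_verts nn by (intro sum_mono2) auto
  finally show ?thesis by (simp add: sum_out_capital sum_in_capital)
qed

lemma finite_channels: "finite (channels G)"
proof -
  have "channels G = (\<lambda>(u, v). {u, v}) ` parcs G" by (auto simp: channels_def)
  then show ?thesis using pair_finite_arcs by simp
qed

text \<open>
  Each vertex v other than z is sent to the first channel of a shortest walk from v to z; this is
  injective because the channel leads to a vertex strictly closer to z.
\<close>
lemma card_channels_ge:
  assumes "connected G" "z \<in> pverts G"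
  shows "card (pverts G - {z}) \<le> card (channels G)"
proof -
  have sc: "strongly_connected G"
    using symmetric_connected_imp_strongly_connected assms(1) pair_sym_arcs by blast
  \<comment> \<open>The distance to \<open>z\<close>; strong connectivity ensures that the minimum
    is attained at every vertex.\<close>
  define n where "n v = (LEAST k. \<exists>p. awalk v p z \<and> length p = k)" for v
  have "\<exists>w. (v, w) \<in> parcs G \<and> n w < n v" if v: "v \<in> pverts G - {z}" for v
  proof -
    have "v \<rightarrow>\<^sup>*\<^bsub>G\<^esub> z" using sc v assms(2) by (auto simp: strongly_connected_def)
    then obtain p0 where "awalk v p0 z" by (auto simp: reachable_awalk)
    then have "\<exists>p. awalk v p z \<and> length p = n v"
      unfolding n_def
      using LeastI_ex[of "\<lambda>k. \<exists>p. awalk v p z \<and> length p = k"] by blast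
    then obtain p where p: "awalk v p z" "length p = n v" by blast
    \<comment> \<open>Since \<open>v \<noteq> z\<close>, a shortest walk has a first arc, and the
      rest of it bounds the distance from the head of that arc.\<close>
    with v obtain e p' where "p = e # p'" by (cases p) (auto simp: awalk_Nil_iff)
    with p have e: "e \<in> parcs G" "fst e = v" "awalk (snd e) p' z" "Suc (length p') = n v"
      by (auto simp: awalk_Cons_iff)
    have "n (snd e) \<le> length p'" unfolding n_def using e(3) by (blast intro: Least_le)
    with e show ?thesis by (intro exI[of _ "snd e"]) auto
  qed
  then obtain f where f: "\<And>v. v \<in> pverts G - {z} \<Longrightarrow> (v, f v) \<in> parcs G \<and> n (f v) < n v"
    by metis
  show ?thesis
  proof (rule card_inj_on_le)
    show "inj_on (\<lambda>v. {v, f v}) (pverts G - {z})"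
    proof (rule inj_onI)
      fix u v assume "u \<in> pverts G - {z}" "v \<in> pverts G - {z}" "{u, f u} = {v, f v}"
      \<comment> \<open>Otherwise \<open>u = f v\<close> and \<open>v = f u\<close>, which would
        give \<open>n u < n v < n u\<close>.\<close>
      with f[of u] f[of v] show "u = v" by (auto simp: doubleton_eq_iff)
    qed
    show "(\<lambda>v. {v, f v}) ` (pverts G - {z}) \<subseteq> channels G"
      using f by (auto simp: channels_def)
  qed (rule finite_channels)
qed

end

lemma card_channels_star:
  assumes "finite V"
  shows "card (channels (star z V)) \<le> card (V - {z})"
proof -
  have "channels (star z V) = (\<lambda>v. {z, v}) ` (V - {z})"
    by (auto simp: channels_def)
  then show ?thesis using assms by (simp add: card_image_le)
qed

theorem theorem10:
  fixes ts :: "'a transaction list"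
    and eps :: real
    and G :: "'a pair_pre_digraph"
    and T :: "nat set"
    and c :: "'a capital"
    and z :: 'a
  assumes "\<forall>(s, r, x)\<in>set ts. x > 0"
    and "optimal_network eps ts G T c"
    and "Digraph_Component.connected (with_proj G)"
    and "z \<in> pverts G"
  shows "\<exists>c\<^sub>S. executes (star z (pverts G)) c\<^sub>S (nths ts T)
            \<and> total_capital (star z (pverts G)) c\<^sub>S \<le> 2 * total_capital G c
            \<and> approx_network 2 eps ts (star z (pverts G)) T c\<^sub>S"
proof -
  let ?S = "star z (pverts G)" and ?c = "star_capital z G c"
  have max: "max_profit_network eps ts G T c"
    and net: "network ts G T c"
    using assms(2) by (auto simp: optimal_network_def max_profit_network_def)
  interpret pair_graph G using net by (simp add: network_def)
  have ex: "executes G c (nths ts T)" using net by (simp add: network_def)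
  then have nn: "nonneg_capital G c" by (cases "nths ts T") auto
  have exS: "executes ?S ?c (nths ts T)" by (rule executes_star[OF ex assms(4)]) simp
  have total: "total_capital ?S ?c \<le> 2 * total_capital G c"
    by (rule total_star_capital_le[OF nn])
  have "card (channels ?S) \<le> card (channels G)"
    using card_channels_star[OF pair_finite_verts] card_channels_ge[OF assms(3,4)] le_trans by blast
  \<comment> \<open>Both networks execute the same \<open>T\<close>, so the fees agree and only the
    channel counts matter.\<close>
  then have "profit eps G T \<le> profit eps ?S T" by (simp add: profit_def)
  moreover have "network ts ?S T ?c"
    using net exS pair_graph_star[OF assms(4)] by (simp add: network_def)
  ultimately have maxS: "max_profit_network eps ts ?S T ?c"
    using max by (meson max_profit_network_def order_trans)
  have "total_capital ?S ?c \<le> 2 * total_capital G' c'" if "optimal_network eps ts G' I' c'"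
    for G' I' c'
  proof -
    \<comment> \<open>\<open>G'\<close> has maximum profit as well, so it competes in the minimality
      of the capital of \<open>G\<close>.\<close>
    have "total_capital G c \<le> total_capital G' c'"
      using assms(2) that by (auto simp: optimal_network_def)
    with total show ?thesis by simp
  qed
  with maxS have "approx_network 2 eps ts ?S T ?c" by (simp add: approx_network_def)
  with exS total show ?thesis by blast
qed

end
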